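(* For any infinite $E\subset\mathbb{N}$, every $E$-intersective set is intersective.
   Context: $\mathbb{N}=\{1,2,3,\dots\}$, $[N]=\{1,\dots,N\}$. For $A,E\subset\mathbb{N}$, $E$ infinite, $\overline{d}_E(A)=\limsup_{N\to\infty}\frac{|A\cap E\cap[N]|}{|E\cap[N]|}$. $A-A=\{a-b:a,b\in A\}$. A set $R\subset\mathbb{N}$ is $E$-intersective if for every $A\subset E$ with $\overline{d}_E(A)>0$ we have $R\cap(A-A)\neq\varnothing$; $R$ is intersective if it is $\mathbb{N}$-intersective. *)

theory Defs
  imports "HOL-Analysis.Analysis"
begin

text \<open>The natural numbers start at 1 here, so all sets are subsets of \<open>{1..} :: nat set\<close>.\<close>

text \<open>
  For infinite \<open>E\<close> the denominator vanishes for only finitely many \<open>N\<close>; the limes superior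
  is unaffected by the convention \<open>x / 0 = 0\<close>.
\<close>
definition rel_upper_density :: "nat set \<Rightarrow> nat set \<Rightarrow> ereal" where
  "rel_upper_density E A =
     limsup (\<lambda>N. ereal (real (card (A \<inter> E \<inter> {1..N})) / real (card (E \<inter> {1..N}))))"

text \<open>Differences are formed in the integers, since subtraction on \<^typ>\<open>nat\<close> truncates.\<close>
definition difference_set :: "nat set \<Rightarrow> int set" where
  "difference_set A = {int a - int b | a b. a \<in> A \<and> b \<in> A}"

definition rel_intersective :: "nat set \<Rightarrow> nat set \<Rightarrow> bool" where
  "rel_intersective E R \<longleftrightarrow>
     R \<subseteq> {1..} \<and>
     (\<forall>A. A \<subseteq> E \<and> rel_upper_density E A > 0 \<longrightarrow> int ` R \<inter> difference_set A \<noteq> {})"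

definition intersective :: "nat set \<Rightarrow> bool" where
  "intersective R \<longleftrightarrow> rel_intersective {1..} R"

end

theory Submission
  imports Defs
begin

text \<open>
  Let \<open>A\<close> have upper density greater than \<open>\<delta> > 0\<close> along \<open>M 0 < M 1 < \<dots>\<close>. For every \<open>N\<close>, the translate
  \<open>A - t\<close> by a random \<open>t \<le> M k\<close> has expected relative density in \<open>E \<inter> [N]\<close> about \<open>\<delta>\<close>, so the set \<open>G N\<close>
  of those \<open>t\<close> for which this density is at least \<open>\<delta> / 2\<close> has probability at least \<open>\<delta> / 4\<close> for large \<open>k\<close>.
  Pass to a finitely additive limit \<open>\<mu>\<close> of these probabilities (Tychonoff). As in Fatou's lemma there
  are \<open>m i\<close> such that any finitely many of the unions \<open>G i \<union> \<dots> \<union> G (m i)\<close> have a common point \<open>t\<close>. A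
  limit \<open>X\<close> of the corresponding translates of \<open>A\<close> then has density at least \<open>\<delta> / 2\<close> in \<open>E \<inter> [N]\<close> for
  infinitely many \<open>N\<close>, and \<open>X - X \<subseteq> A - A\<close> because every finite part of \<open>X\<close> lies in a translate of \<open>A\<close>.
\<close>

section \<open>Cluster points and finitely additive limits\<close>

text \<open>By Tychonoff the cube of functions into \<open>{0..1}\<close> is compact, and a basic
  neighbourhood restricts only finitely many coordinates. The index type may be uncountable, so a
  cluster point takes the place of a convergent subsequence.\<close>

lemma unit_interval_functions_cluster_point:
  fixes u :: "nat \<Rightarrow> 'i \<Rightarrow> real"
  assumes u: "\<And>n i. u n i \<in> {0..1}"
  obtains c where "\<And>I \<epsilon> K. finite I \<Longrightarrow> \<epsilon> > 0 \<Longrightarrow> \<exists>n\<ge>K. \<forall>i\<in>I. \<bar>u n i - c i\<bar> < \<epsilon>"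
proof -
  define C where "C = PiE UNIV (\<lambda>_::'i. {0..1::real})"
  have "compactin (product_topology (\<lambda>_::'i. euclidean :: real topology) UNIV) C"
    unfolding C_def compactin_PiE by auto
  hence "compact C"
    by (simp add: euclidean_product_topology)
  moreover have "filtermap u sequentially \<noteq> bot"
    by (simp add: filtermap_bot_iff)
  moreover have "eventually (\<lambda>x. x \<in> C) (filtermap u sequentially)"
    using u unfolding C_def eventually_filtermap by (intro always_eventually) blast
  ultimately obtain c where c: "inf (nhds c) (filtermap u sequentially) \<noteq> bot"
    unfolding compact_filter by blast
  have "\<exists>n\<ge>K. \<forall>i\<in>I. \<bar>u n i - c i\<bar> < \<epsilon>" if "finite I" "\<epsilon> > 0" for I \<epsilon> K
  proof (rule ccontr)
    define U where "U = (\<Inter>i\<in>I. {f. \<bar>f i - c i\<bar> < \<epsilon>})"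
    assume "\<not> ?thesis"
    hence "eventually (\<lambda>n. u n \<notin> U) sequentially"
      unfolding U_def eventually_sequentially by fastforce
    hence "eventually (\<lambda>f. f \<notin> U) (filtermap u sequentially)"
      by (simp add: eventually_filtermap)
    moreover have "open U"
      unfolding U_def using \<open>finite I\<close>
      by (intro open_INT ballI open_Collect_less continuous_intros
          continuous_on_product_coordinates)
    hence "eventually (\<lambda>f. f \<in> U) (nhds c)"
      using \<open>\<epsilon> > 0\<close> by (intro eventually_nhds_in_open) (auto simp: U_def)
    ultimately have "eventually (\<lambda>_. False) (inf (nhds c) (filtermap u sequentially))"
      unfolding eventually_inf by blast
    with c show False
      by (simp add: trivial_limit_def)
  qed
  thus ?thesis using that by blast
qed

text \<open>A cluster point of the functions \<open>D k\<close> on all sets at once: relations among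
  finitely many sets pass to it.\<close>

lemma finitely_additive_density:
  fixes M :: "nat \<Rightarrow> nat"
  defines "D \<equiv> \<lambda>k S. real (card (S \<inter> {1..M k})) / real (M k)"
  obtains \<mu> :: "nat set \<Rightarrow> real" where
    "\<And>S T. S \<inter> T = {} \<Longrightarrow> \<mu> (S \<union> T) = \<mu> S + \<mu> T"
    "\<And>S. 0 \<le> \<mu> S" "\<And>S. \<mu> S \<le> 1"
    "\<And>S c. eventually (\<lambda>k. c \<le> D k S) sequentially \<Longrightarrow> c \<le> \<mu> S"
proof -
  have D01: "D k S \<in> {0..1}" for k S
  proof -
    have "card (S \<inter> {1..M k}) \<le> M k"
      using card_mono[of "{1..M k}" "S \<inter> {1..M k}"] by simp
    thus ?thesis
      by (auto simp: D_def divide_le_eq_1)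
  qed
  obtain \<mu> where \<mu>: "\<And>I \<epsilon> K. finite I \<Longrightarrow> \<epsilon> > 0 \<Longrightarrow> \<exists>k\<ge>K. \<forall>S\<in>I. \<bar>D k S - \<mu> S\<bar> < \<epsilon>"
    using unit_interval_functions_cluster_point[of D] D01 by blast
  have lower: "c \<le> \<mu> S" if ev: "eventually (\<lambda>k. c \<le> D k S) sequentially" for S c
  proof (rule field_le_epsilon)
    fix e :: real assume "e > 0"
    obtain K where "\<And>k. k \<ge> K \<Longrightarrow> c \<le> D k S"
      using ev unfolding eventually_sequentially by blast
    moreover obtain k where "k \<ge> K" "\<bar>D k S - \<mu> S\<bar> < e"
      using \<mu>[of "{S}" e K] \<open>e > 0\<close> by auto
    ultimately show "c \<le> \<mu> S + e"
      by fastforce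
  qed
  have upper: "\<mu> S \<le> 1" for S
  proof (rule field_le_epsilon)
    fix e :: real assume "e > 0"
    then obtain k where "\<bar>D k S - \<mu> S\<bar> < e"
      using \<mu>[of "{S}" e 0] by auto
    thus "\<mu> S \<le> 1 + e"
      using D01[of k S] by auto
  qed
  have add: "\<mu> (S \<union> T) = \<mu> S + \<mu> T" if "S \<inter> T = {}" for S T
  proof -
    have D_add: "D k (S \<union> T) = D k S + D k T" for k
    proof -
      have "card ((S \<union> T) \<inter> {1..M k}) = card (S \<inter> {1..M k}) + card (T \<inter> {1..M k})"
        using that by (subst card_Un_disjoint[symmetric]) (auto intro: arg_cong[where f = card])
      thus ?thesis
        by (simp add: D_def add_divide_distrib)
    qed
    have "\<bar>\<mu> (S \<union> T) - (\<mu> S + \<mu> T)\<bar> \<le> 0 + e" if "e > 0" for e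
    proof -
      \<comment> \<open>A single \<open>k\<close> approximates all three values, and
        \<open>D k\<close> is exactly additive.\<close>
      obtain k where "\<forall>X\<in>{S, T, S \<union> T}. \<bar>D k X - \<mu> X\<bar> < e / 3"
        using \<mu>[of "{S, T, S \<union> T}" "e / 3" 0] \<open>e > 0\<close> by auto
      hence "\<bar>D k S - \<mu> S\<bar> < e / 3" "\<bar>D k T - \<mu> T\<bar> < e / 3" "\<bar>D k (S \<union> T) - \<mu> (S \<union> T)\<bar> < e / 3"
        by blast+
      thus ?thesis
        using D_add[of k] by linarith
    qed
    hence "\<bar>\<mu> (S \<union> T) - (\<mu> S + \<mu> T)\<bar> \<le> 0"
      by (rule field_le_epsilon)
    thus ?thesis by simp
  qed
  show ?thesis
    using that[of \<mu>] add upper lower D01 by simp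
qed

section \<open>Finitely additive Fatou lemma\<close>

text \<open>
  A finitely additive substitute for the inequality
  \<open>\<mu> (limsup G) \<ge> limsup (\<mu> \<circ> G)\<close>: choosing \<open>m i\<close> so that the \<open>i\<close>-th finite union almost exhausts
  the supremal measure makes every later union almost contained in it.
\<close>
lemma finitely_additive_limsup_nonempty:
  fixes \<mu> :: "'a set \<Rightarrow> real" and G :: "nat \<Rightarrow> 'a set"
  assumes add: "\<And>S T. S \<inter> T = {} \<Longrightarrow> \<mu> (S \<union> T) = \<mu> S + \<mu> T"
    and nonneg: "\<And>S. 0 \<le> \<mu> S" and bound: "\<And>S. \<mu> S \<le> 1"
    and c: "c > 0" "\<And>N. c \<le> \<mu> (G N)"
  shows "\<exists>m. \<forall>n::nat. (\<Inter>i\<le>n. \<Union>N\<in>{i..m i}. G N) \<noteq> {}"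
proof -
  have mono: "\<mu> S \<le> \<mu> T" if "S \<subseteq> T" for S T
  proof -
    have "\<mu> T = \<mu> S + \<mu> (T - S)"
      using add[of S "T - S"] that by (simp add: Un_absorb1)
    thus ?thesis using nonneg[of "T - S"] by simp
  qed
  define s where "s i = (SUP m. \<mu> (\<Union>N\<in>{i..m}. G N))" for i
  have bdd: "bdd_above (range (\<lambda>m. \<mu> (\<Union>N\<in>{i..m}. G N)))" for i
    using bound by (auto intro!: bdd_aboveI)
  \<comment> \<open>The slacks \<open>c / 2 ^ (i + 2)\<close> add up to only
    \<open>c / 2\<close>.\<close>
  have "\<exists>m. s i - c / 2 ^ (i + 2) < \<mu> (\<Union>N\<in>{i..m}. G N)" for i
  proof -
    have "s i - c / 2 ^ (i + 2) < s i" using c(1) by simp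
    thus ?thesis
      unfolding s_def using less_cSUP_iff[OF _ bdd] by blast
  qed
  then obtain m where m: "\<And>i. s i - c / 2 ^ (i + 2) < \<mu> (\<Union>N\<in>{i..m i}. G N)"
    by metis
  define V where "V i = (\<Union>N\<in>{i..m i}. G N)" for i
  \<comment> \<open>\<open>V k \<union> V n\<close> lies in one of the unions defining
    \<open>s k\<close>, so it exceeds \<open>V k\<close> by at most the slack.\<close>
  have diff: "\<mu> (V n - V k) \<le> c / 2 ^ (k + 2)" if "k \<le> n" for k n
  proof -
    have "\<mu> (V k) + \<mu> (V n - V k) = \<mu> (V k \<union> V n)"
      using add[of "V k" "V n - V k"] by simp
    also have "\<dots> \<le> \<mu> (\<Union>N\<in>{k..max (m k) (m n)}. G N)"
      using that by (intro mono) (fastforce simp: V_def)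
    also have "\<dots> \<le> s k"
      unfolding s_def by (rule cSUP_upper[OF _ bdd]) simp
    finally show ?thesis
      using m[of k] by (simp add: V_def)
  qed
  have "(\<Inter>i\<le>n. V i) \<noteq> {}" for n
  proof -
    \<comment> \<open>Intersecting with each \<open>V i\<close> costs at most its slack; the first
      \<open>k\<close> slacks sum to \<open>c / 2 - c / 2 ^ (k + 1)\<close>.\<close>
    have step: "\<mu> (V n) - c / 2 + c / 2 ^ (k + 1) \<le> \<mu> (V n \<inter> (\<Inter>i<k. V i))"
      if "k \<le> Suc n" for k
      using that
    proof (induction k)
      case (Suc k)
      define Y where "Y = V n \<inter> (\<Inter>i<k. V i)"
      have "\<mu> Y = \<mu> (Y \<inter> V k) + \<mu> (Y - V k)"
        using add[of "Y \<inter> V k" "Y - V k"] by (simp add: Int_Diff_Un Int_Diff_disjoint)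
      moreover have "\<mu> (Y - V k) \<le> c / 2 ^ (k + 2)"
        using mono[of "Y - V k" "V n - V k"] diff[of k n] Suc.prems by (force simp: Y_def)
      moreover have "V n \<inter> (\<Inter>i<Suc k. V i) = Y \<inter> V k"
        by (auto simp: Y_def lessThan_Suc)
      moreover have "c / 2 ^ (k + 1) = c / 2 ^ (k + 2) + c / 2 ^ (Suc k + 1)"
        by (simp add: field_simps)
      ultimately show ?case
        using Suc.IH Suc.prems by (simp add: Y_def)
    qed simp
    \<comment> \<open>Hence \<open>\<mu> (V n)\<close> exceeds \<open>c - c / 4\<close>, more than
      the total loss.\<close>
    have "c / 2 ^ (n + 2) \<le> c / 4"
      using c(1) by (simp add: field_simps)
    moreover have "c \<le> s n"
      using c(2)[of n] cSUP_upper[OF UNIV_I bdd[of n], of n] by (simp add: s_def)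
    moreover have "c / 2 ^ (Suc n + 1) > 0"
      using c(1) by simp
    ultimately have "0 < \<mu> (V n \<inter> (\<Inter>i<Suc n. V i))"
      using step[of "Suc n"] m[of n] c(1) by (simp add: V_def)
    moreover have "\<mu> {} = 0"
      using add[of "{}" "{}"] by simp
    ultimately have "V n \<inter> (\<Inter>i<Suc n. V i) \<noteq> {}"
      by force
    thus ?thesis
      by (auto simp: lessThan_Suc_atMost)
  qed
  thus ?thesis
    by (auto simp only: V_def)
qed

section \<open>Averaging over translates\<close>

text \<open>An element \<open>a > e\<close> is hit by \<open>t = a - e\<close>; at most
  \<open>e\<close> elements of \<open>A\<close> are lost.\<close>

lemma card_translate_ge:
  fixes A :: "nat set"
  assumes "e \<le> N"
  shows "card (A \<inter> {1..M}) \<le> card {t \<in> {1..M}. t + e \<in> A} + N"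
proof -
  have "A \<inter> {1..M} \<subseteq> (\<lambda>t. t + e) ` {t \<in> {1..M}. t + e \<in> A} \<union> {1..e}"
  proof
    fix a assume a: "a \<in> A \<inter> {1..M}"
    show "a \<in> (\<lambda>t. t + e) ` {t \<in> {1..M}. t + e \<in> A} \<union> {1..e}"
    proof (cases "a \<le> e")
      case False
      with a have "a - e \<in> {t \<in> {1..M}. t + e \<in> A}" "a = (a - e) + e"
        by auto
      thus ?thesis by blast
    qed (use a in auto)
  qed
  hence "card (A \<inter> {1..M}) \<le> card ((\<lambda>t. t + e) ` {t \<in> {1..M}. t + e \<in> A} \<union> {1..e})"
    by (intro card_mono) auto
  also have "\<dots> \<le> card ((\<lambda>t. t + e) ` {t \<in> {1..M}. t + e \<in> A}) + card {1..e}"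
    by (rule card_Un_le)
  also have "\<dots> \<le> card {t \<in> {1..M}. t + e \<in> A} + N"
    using assms card_image_le[of "{t \<in> {1..M}. t + e \<in> A}" "\<lambda>t. t + e"] by simp
  finally show ?thesis .
qed

text \<open>Markov's inequality, after counting the pairs \<open>(t, e)\<close> with \<open>t + e \<in> A\<close> in two ways.\<close>
lemma card_dense_translates_ge:
  fixes A F :: "nat set" and \<eta> :: real
  assumes F: "F \<subseteq> {..N}" "F \<noteq> {}" and "\<eta> \<ge> 0"
  defines "G \<equiv> {t. \<eta> * real (card F) \<le> real (card {e \<in> F. t + e \<in> A})}"
  shows "real (card (A \<inter> {1..M})) - real N - \<eta> * real M \<le> real (card (G \<inter> {1..M}))"
proof -
  have fin: "finite F"
    using F(1) finite_subset by blast
  have pos: "real (card F) > 0"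
    using fin F(2) by (simp add: card_gt_0_iff)
  have "real (card F) * (real (card (A \<inter> {1..M})) - real N)
      = (\<Sum>e\<in>F. real (card (A \<inter> {1..M})) - real N)"
    by simp
  also have "\<dots> \<le> (\<Sum>e\<in>F. real (card {t \<in> {1..M}. t + e \<in> A}))"
  proof (rule sum_mono)
    fix e assume "e \<in> F"
    with F(1) have "e \<le> N" by auto
    from card_translate_ge[OF this, of A M]
    show "real (card (A \<inter> {1..M})) - real N \<le> real (card {t \<in> {1..M}. t + e \<in> A})"
      by linarith
  qed
  also have "\<dots> = (\<Sum>t\<in>{1..M}. real (card {e \<in> F. t + e \<in> A}))"
    using sum_multicount_gen[of "{1..M}" F "\<lambda>t e. t + e \<in> A" "\<lambda>e. card {t \<in> {1..M}. t + e \<in> A}"] fin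
    by (simp flip: of_nat_sum)
  \<comment> \<open>A point of \<open>G\<close> contributes at most \<open>card F\<close>, any other
    less than \<open>\<eta> * card F\<close>.\<close>
  also have "\<dots> \<le> (\<Sum>t\<in>{1..M}. real (card F) * indicator G t + \<eta> * real (card F))"
  proof (rule sum_mono)
    fix t
    have "card {e \<in> F. t + e \<in> A} \<le> card F"
      using fin by (intro card_mono) auto
    moreover have "0 \<le> \<eta> * real (card F)"
      using \<open>\<eta> \<ge> 0\<close> by simp
    ultimately show "real (card {e \<in> F. t + e \<in> A}) \<le> real (card F) * indicator G t + \<eta> * real (card F)"
      by (auto simp: G_def indicator_def)
  qed
  also have "\<dots> = real (card F) * (real (card (G \<inter> {1..M})) + \<eta> * real M)"
    by (simp add: sum.distrib sum_distrib_left[symmetric] indicator_def sum.If_cases Int_commute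
        algebra_simps)
  finally show ?thesis
    using pos by (simp add: mult_le_cancel_left)
qed

section \<open>The limit translate\<close>

text \<open>Finite additivity yields no single \<open>t\<close> lying in infinitely many
  \<open>G N\<close>, so \<open>X\<close> is a limit of translates that agrees with one on each
  initial segment.\<close>

lemma exists_dense_limit_translate:
  fixes A E :: "nat set"
  assumes "\<delta> > 0"
    and dense: "\<exists>\<^sub>\<infinity>M. \<delta> * real M < real (card (A \<inter> {1..M}))"
  obtains X where
    "\<And>n. \<exists>t. \<forall>e\<le>n. e \<in> X \<longleftrightarrow> t + e \<in> A"
    "\<exists>\<^sub>\<infinity>N. \<delta> / 2 * real (card (E \<inter> {1..N})) \<le> real (card (X \<inter> E \<inter> {1..N}))"
proof -
  define P where "P N Y \<longleftrightarrow> \<delta> / 2 * real (card (E \<inter> {1..N})) \<le> real (card (Y \<inter> E \<inter> {1..N}))"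
    for N and Y :: "nat set"
  define G where "G N = {t. P N {e. t + e \<in> A}}" for N
  obtain M :: "nat \<Rightarrow> nat" where M: "strict_mono M" "\<And>k. \<delta> * real (M k) < real (card (A \<inter> {1..M k}))"
    using infinite_enumerate[of "{M. \<delta> * real M < real (card (A \<inter> {1..M}))}"] dense
    unfolding INFM_iff_infinite by auto
  obtain \<mu> :: "nat set \<Rightarrow> real" where \<mu>:
    "\<And>S T. S \<inter> T = {} \<Longrightarrow> \<mu> (S \<union> T) = \<mu> S + \<mu> T" "\<And>S. 0 \<le> \<mu> S" "\<And>S. \<mu> S \<le> 1"
    "\<And>S c. eventually (\<lambda>k. c \<le> real (card (S \<inter> {1..M k})) / real (M k)) sequentially \<Longrightarrow> c \<le> \<mu> S"
    using finitely_additive_density[of M] by blast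
  have \<mu>_G: "\<delta> / 4 \<le> \<mu> (G N)" for N
  proof (rule \<mu>(4))
    \<comment> \<open>As \<open>M k \<ge> k\<close>, the boundary loss \<open>N\<close> is at most
      \<open>\<delta> / 4 * M k\<close>, leaving
      \<open>\<delta> - \<delta> / 2 - \<delta> / 4\<close>.\<close>
    have "\<delta> / 4 \<le> real (card (G N \<inter> {1..M k})) / real (M k)"
      if k: "k \<ge> nat \<lceil>4 * real N / \<delta>\<rceil> + 1" for k
    proof -
      have "k \<le> M k" using M(1) by (rule strict_mono_imp_increasing)
      hence Mk: "M k > 0" "4 * real N / \<delta> \<le> real (M k)"
        using k by linarith+
      have N: "real N \<le> \<delta> / 4 * real (M k)"
        using Mk(2) \<open>\<delta> > 0\<close> by (simp add: field_simps)
      have "\<delta> / 4 * real (M k) \<le> real (card (G N \<inter> {1..M k}))"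
      proof (cases "E \<inter> {1..N} = {}")
        \<comment> \<open>Averaging needs a nonempty set; here \<open>P N\<close> is trivial, and
          \<open>\<delta> \<le> 1\<close> suffices.\<close>
        case True
        have "\<delta> * real (M k) \<le> real (M k)"
          using M(2)[of k] card_mono[of "{1..M k}" "A \<inter> {1..M k}"] by simp
        moreover have "G N = UNIV"
          using True by (auto simp: G_def P_def)
        ultimately show ?thesis
          using \<open>\<delta> > 0\<close> by (simp add: mult_nonneg_nonneg)
      next
        case False
        have G_eq: "G N = {t. \<delta> / 2 * real (card (E \<inter> {1..N})) \<le> real (card {e \<in> E \<inter> {1..N}. t + e \<in> A})}"
          by (auto simp: G_def P_def Int_def conj_ac)
        have "real (card (A \<inter> {1..M k})) - real N - \<delta> / 2 * real (M k) \<le> real (card (G N \<inter> {1..M k}))"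
          unfolding G_eq using False \<open>\<delta> > 0\<close> by (intro card_dense_translates_ge) auto
        thus ?thesis
          using M(2)[of k] N by linarith
      qed
      thus ?thesis
        using Mk(1) by (simp add: field_simps)
    qed
    thus "eventually (\<lambda>k. \<delta> / 4 \<le> real (card (G N \<inter> {1..M k})) / real (M k)) sequentially"
      unfolding eventually_sequentially by blast
  qed
  have "\<delta> / 4 > 0"
    using \<open>\<delta> > 0\<close> by simp
  then obtain m where "\<forall>n. (\<Inter>i\<le>n. \<Union>N\<in>{i..m i}. G N) \<noteq> {}"
    using finitely_additive_limsup_nonempty[of \<mu> "\<delta> / 4" G, OF \<mu>(1-3) _ \<mu>_G] by blast
  hence "\<forall>n. \<exists>t. t \<in> (\<Inter>i\<le>n. \<Union>N\<in>{i..m i}. G N)"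
    by (meson ex_in_conv)
  then obtain t where "\<forall>n. t n \<in> (\<Inter>i\<le>n. \<Union>N\<in>{i..m i}. G N)"
    by (rule choice[THEN exE])
  \<comment> \<open>The bound \<open>m i\<close> does not depend on \<open>n\<close>: agreement of
    \<open>X\<close> with a late translate up to \<open>m i\<close> is enough to inherit some
    \<open>P N\<close> with \<open>N \<ge> i\<close>.\<close>
  hence t: "\<exists>N\<in>{i..m i}. t n \<in> G N" if "i \<le> n" for n i
    using that by fastforce
  obtain x where x: "\<And>I \<epsilon> K. finite I \<Longrightarrow> \<epsilon> > 0 \<Longrightarrow>
      \<exists>n\<ge>K. \<forall>e\<in>I. \<bar>indicator {e. t n + e \<in> A} e - x e\<bar> < (\<epsilon>::real)"
    using unit_interval_functions_cluster_point[of "\<lambda>n. indicator {e. t n + e \<in> A}"]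
    by (auto simp: indicator_def)
  \<comment> \<open>The approximants take only the values 0 and 1, so an error below 1/2 lets this
    threshold recover membership.\<close>
  define X where "X = {e. x e > 1 / 2}"
  have X: "\<exists>n\<ge>K. \<forall>e\<le>l. e \<in> X \<longleftrightarrow> t n + e \<in> A" for K l
  proof -
    obtain n where n: "n \<ge> K" "\<forall>e\<in>{..l}. \<bar>indicator {e. t n + e \<in> A} e - x e\<bar> < 1 / 2"
      using x[of "{..l}" "1 / 2" K] by auto
    have "e \<in> X \<longleftrightarrow> t n + e \<in> A" if "e \<le> l" for e
      using n(2)[rule_format, of e] that
      by (cases "t n + e \<in> A") (simp_all add: X_def abs_if split: if_splits)
    thus ?thesis using n(1) by blast
  qed
  have "\<exists>N\<ge>i. P N X" for i
  proof -
    obtain n where n: "n \<ge> i" "\<forall>e\<le>m i. e \<in> X \<longleftrightarrow> t n + e \<in> A"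
      using X[of i "m i"] by blast
    obtain N where N: "N \<in> {i..m i}" "t n \<in> G N"
      using t[OF n(1)] by blast
    have "{e. t n + e \<in> A} \<inter> E \<inter> {1..N} = X \<inter> E \<inter> {1..N}"
      using n(2) N(1) by auto
    with N show ?thesis
      by (auto simp: G_def P_def)
  qed
  hence "\<exists>\<^sub>\<infinity>N. P N X"
    unfolding INFM_nat_le by blast
  with that[of X] X show ?thesis
    unfolding P_def by blast
qed

section \<open>Transfer of intersectivity\<close>

theorem theoremD:
  fixes E R :: "nat set"
  assumes "E \<subseteq> {1..}"
    and "infinite E"
    and "rel_intersective E R"
  shows "intersective R"
  unfolding intersective_def rel_intersective_def
proof (intro conjI allI impI)
  show "R \<subseteq> {1..}"
    using assms(3) by (simp add: rel_intersective_def)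
next
  fix A :: "nat set"
  assume A: "A \<subseteq> {1..} \<and> 0 < rel_upper_density {1..} A"
  then obtain \<delta> :: real where \<delta>: "0 < \<delta>" "ereal \<delta> < rel_upper_density {1..} A"
    using ereal_dense2[of 0 "rel_upper_density {1..} A"] by auto
  have "\<exists>\<^sub>\<infinity>M. \<delta> < real (card (A \<inter> {1..M})) / real M"
  proof (rule ccontr)
    assume "\<not> ?thesis"
    hence "eventually (\<lambda>M. real (card (A \<inter> {1..M})) / real M \<le> \<delta>) sequentially"
      by (simp add: not_frequently not_less cofinite_eq_sequentially)
    moreover have "A \<inter> {1..} \<inter> {1..M} = A \<inter> {1..M}" "{1..} \<inter> {1..M} = {1..M}" for M :: nat
      by auto
    ultimately have "rel_upper_density {1..} A \<le> ereal \<delta>"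
      unfolding rel_upper_density_def by (intro Limsup_bounded) simp
    with \<delta>(2) show False by simp
  qed
  hence "\<exists>\<^sub>\<infinity>M. \<delta> * real M < real (card (A \<inter> {1..M}))"
  proof (rule frequently_elim1)
    fix M assume M: "\<delta> < real (card (A \<inter> {1..M})) / real M"
    \<comment> \<open>For \<open>M = 0\<close> the quotient is 0 by convention, which is not above
      \<open>\<delta>\<close>.\<close>
    hence "M \<noteq> 0"
      using \<delta>(1) by (intro notI) simp
    with M show "\<delta> * real M < real (card (A \<inter> {1..M}))"
      by (simp add: field_simps)
  qed
  then obtain X where X: "\<And>n. \<exists>t. \<forall>e\<le>n. e \<in> X \<longleftrightarrow> t + e \<in> A"
    "\<exists>\<^sub>\<infinity>N. \<delta> / 2 * real (card (E \<inter> {1..N})) \<le> real (card (X \<inter> E \<inter> {1..N}))"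
    using exists_dense_limit_translate \<delta>(1) by blast
  have "ereal (\<delta> / 2) \<le> rel_upper_density E (X \<inter> E)"
  proof (rule ccontr)
    assume "\<not> ?thesis"
    hence "eventually (\<lambda>N. ereal (real (card (X \<inter> E \<inter> E \<inter> {1..N})) / real (card (E \<inter> {1..N})))
        < ereal (\<delta> / 2)) sequentially"
      unfolding rel_upper_density_def by (intro Limsup_lessD) simp
    moreover obtain e where "e \<in> E" "e \<ge> 1"
      using assms(1,2) by (metis atLeast_iff finite.emptyI ex_in_conv subsetD)
    hence "eventually (\<lambda>N. card (E \<inter> {1..N}) > 0) sequentially"
      by (intro eventually_sequentiallyI[of e]) (auto simp: card_gt_0_iff)
    ultimately have "eventually (\<lambda>N. \<not> \<delta> / 2 * real (card (E \<inter> {1..N}))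
        \<le> real (card (X \<inter> E \<inter> {1..N}))) sequentially"
      by eventually_elim (simp add: Int_assoc field_simps)
    with X(2) show False
      by (simp add: frequently_def cofinite_eq_sequentially)
  qed
  moreover have "0 < ereal (\<delta> / 2)"
    using \<delta>(1) by simp
  ultimately have "0 < rel_upper_density E (X \<inter> E)"
    by (rule order.strict_trans2[rotated])
  hence "int ` R \<inter> difference_set (X \<inter> E) \<noteq> {}"
    using assms(3) by (simp add: rel_intersective_def)
  then obtain r a b where r: "r \<in> R" "int r = int a - int b" "a \<in> X" "b \<in> X"
    by (auto simp: difference_set_def)
  \<comment> \<open>One \<open>t\<close> serves both \<open>a\<close> and \<open>b\<close>, so it
    cancels in the difference.\<close>
  obtain t where "\<forall>e\<le>max a b. e \<in> X \<longleftrightarrow> t + e \<in> A"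
    using X(1) by blast
  hence "t + a \<in> A" "t + b \<in> A"
    using r(3,4) by auto
  moreover have "int r = int (t + a) - int (t + b)"
    using r(2) by simp
  ultimately have "int r \<in> difference_set A"
    unfolding difference_set_def by blast
  with r(1) show "int ` R \<inter> difference_set A \<noteq> {}"
    by blast
qed

end
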